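(* Let $k\ge 2$. Then $\hat p$ is the unique $k$-monotone probability $f$ on $\mathbb{N}$ satisfying both of the following conditions: (1) for all $l\in\mathbb{N}$, $F^{k}_{f}(l)-F^{k}_{\tilde p}(l)\ge \beta(f)\,m^k_l$; (2) if $l$ is a $k$-knot of $f$, then the inequality in (1) is an equality.
   Context: $\mathbb{N}=\{0,1,2,\dots\}$. For a real sequence $f=(f(i))_{i\in\mathbb{N}}$, put $\Delta^1 f(i)=f(i+1)-f(i)$ and $\Delta^{k}f(i)=\Delta^{k-1}f(i+1)-\Delta^{k-1}f(i)$. The sequence $f$ is $k$-monotone if $(-1)^k\Delta^k f(i)\ge 0$ for all $i\in\mathbb{N}$; a $k$-knot of a $k$-monotone $f$ is an integer $i\in\mathbb{N}$ with $(-1)^k\Delta^k f(i)>0$. A $k$-monotone probability is a probability mass function on $\mathbb{N}$ that is $k$-monotone; $\mathcal{P}^k$ is the set of these. $X_1,\dots,X_n$ are $n\ge 1$ i.i.d. observations in $\mathbb{N}$, and $\tilde p(j)=\frac1n\sum_{i=1}^n \mathbb{I}_{\{X_i=j\}}$ is the empirical probability mass function. The constrained least-squares estimator is $\hat p=\operatorname{argmin}\{\|f-\tilde p\|_2^2 : f\in\mathcal{P}^k\}$, where $\|g\|_2^2=\sum_{i\ge 0}g(i)^2$ (this minimizer exists and is unique). Iterated primitives: $F^1_f(l)=\sum_{i=0}^l f(i)$ and $F^j_f(l)=\sum_{i=0}^l F^{j-1}_f(i)$ for $j\ge 2$. Splines: $\bar Q^k_j(i)=\binom{j-i+k-1}{k-1}\mathbb{I}_{\{j\ge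 i\}}$ for $i,j\in\mathbb{N}$, with mass $m^k_j=\sum_{i=0}^j \bar Q^k_j(i)$. Finally $\beta(f)=\sum_{i=0}^\infty f(i)\,(f(i)-\tilde p(i))$. *)

theory Defs
  imports "HOL-Probability.Probability"
begin

primrec fdiff :: "nat \<Rightarrow> (nat \<Rightarrow> real) \<Rightarrow> nat \<Rightarrow> real" where
  "fdiff 0 f i = f i"
| "fdiff (Suc k) f i = fdiff k f (i + 1) - fdiff k f i"

definition k_monotone :: "nat \<Rightarrow> (nat \<Rightarrow> real) \<Rightarrow> bool" where
  "k_monotone k f \<longleftrightarrow> (\<forall>i. (-1) ^ k * fdiff k f i \<ge> 0)"

definition k_knot :: "nat \<Rightarrow> (nat \<Rightarrow> real) \<Rightarrow> nat \<Rightarrow> bool" where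
  "k_knot k f i \<longleftrightarrow> (-1) ^ k * fdiff k f i > 0"

text \<open>Probabilities on the naturals are represented by their mass functions \<open>nat \<Rightarrow> real\<close>,
  i.e. by the values of the library function \<open>pmf\<close>.\<close>

definition k_monotone_probs :: "nat \<Rightarrow> (nat \<Rightarrow> real) set" where
  "k_monotone_probs k = {f \<in> range pmf. k_monotone k f}"

definition empirical :: "nat \<Rightarrow> (nat \<Rightarrow> nat) \<Rightarrow> nat \<Rightarrow> real" where
  "empirical n x j = 1 / real n * (\<Sum>i=1..n. of_bool (x i = j))"

definition l2_norm_sq :: "(nat \<Rightarrow> real) \<Rightarrow> real" where
  "l2_norm_sq g = (\<Sum>i. (g i)\<^sup>2)"

text \<open>In the next definitions \<open>q\<close> stands for the empirical mass function. The series in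
  \<open>lse\<close> and \<open>beta\<close> converge whenever \<open>f\<close> is a mass function and \<open>q\<close> has finite support.\<close>

definition lse :: "nat \<Rightarrow> (nat \<Rightarrow> real) \<Rightarrow> nat \<Rightarrow> real" where
  "lse k q = (ARG_MIN (\<lambda>f. l2_norm_sq (\<lambda>i. f i - q i)) f. f \<in> k_monotone_probs k)"

definition beta :: "(nat \<Rightarrow> real) \<Rightarrow> (nat \<Rightarrow> real) \<Rightarrow> real" where
  "beta q f = (\<Sum>i. f i * (f i - q i))"

primrec iter_prim :: "nat \<Rightarrow> (nat \<Rightarrow> real) \<Rightarrow> nat \<Rightarrow> real" where
  "iter_prim 0 f l = f l"
| "iter_prim (Suc j) f l = (\<Sum>i=0..l. iter_prim j f i)"

text \<open>\<open>spline k j\<close> is meant for \<open>k \<ge> 1\<close>, where the truncated subtractions are exact.\<close>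

definition spline :: "nat \<Rightarrow> nat \<Rightarrow> nat \<Rightarrow> real" where
  "spline k j i = (if i \<le> j then real ((j - i + k - 1) choose (k - 1)) else 0)"

definition spline_mass :: "nat \<Rightarrow> nat \<Rightarrow> real" where
  "spline_mass k j = (\<Sum>i=0..j. spline k j i)"

end

theory Submission
  imports Defs "HOL-Real_Asymp.Real_Asymp"
begin

text \<open>Summation by parts writes a \<open>k\<close>-monotone probability \<open>g\<close> as a mixture of splines with weights
  \<open>(-1)^k \<Delta>^k g(j)\<close>, while pairing a sequence with the \<open>j\<close>-th spline gives its \<open>k\<close>-th iterated
  primitive at \<open>j\<close>. Hence condition (1) says that the variational inequality
  \<open>\<langle>g - f, f - q\<rangle> \<ge> 0\<close> holds for normalised splines \<open>g\<close>, equivalently for all \<open>k\<close>-monotone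
  probabilities \<open>g\<close>; taking \<open>g = f\<close> turns it into equality, which forces equality at every knot.
  Mass may escape to infinity along a minimising sequence, so existence of the minimiser is proved
  first among subprobabilities, where the parallelogram law makes minimising sequences Cauchy; the
  minimiser then turns out to have mass 1.\<close>

section \<open>Finite differences and splines\<close>

lemma fdiff_lin: "fdiff k (\<lambda>i. a * f i + b * g i) i = a * fdiff k f i + b * fdiff k g i"
  by (induction k arbitrary: i) (simp_all add: algebra_simps)

text \<open>Peels off the innermost difference instead of the outermost. Its sign is absorbed by
  \<open>(-1) ^ Suc k\<close>, so monotonicity of order \<open>Suc k\<close> reduces to order
  \<open>k\<close> for the decrements.\<close>

lemma fdiff_Suc_shift: "fdiff (Suc k) f i = - fdiff k (\<lambda>i. f i - f (Suc i)) i"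
  by (induction k arbitrary: i) simp_all

lemma k_monotone_lin:
  assumes "k_monotone k f" "k_monotone k g" "0 \<le> a" "0 \<le> b"
  shows "k_monotone k (\<lambda>i. a * f i + b * g i)"
  unfolding k_monotone_def fdiff_lin
proof
  fix i
  have "0 \<le> a * ((-1) ^ k * fdiff k f i) + b * ((-1) ^ k * fdiff k g i)"
    using assms by (auto simp: k_monotone_def)
  then show "0 \<le> (-1) ^ k * (a * fdiff k f i + b * fdiff k g i)"
    by (simp add: algebra_simps)
qed

lemma k_monotone_Suc: "k_monotone (Suc k) f \<longleftrightarrow> k_monotone k (\<lambda>i. f i - f (Suc i))"
  unfolding k_monotone_def fdiff_Suc_shift by simp

lemma tendsto_fdiff:
  assumes "\<And>i. ((\<lambda>n. f n i) \<longlongrightarrow> g i) F"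
  shows "((\<lambda>n. fdiff k (f n) i) \<longlongrightarrow> fdiff k g i) F"
  by (induction k arbitrary: i) (auto intro!: tendsto_diff assms)

lemma fdiff_tendsto_0:
  assumes "f \<longlonglongrightarrow> 0"
  shows "fdiff k f \<longlonglongrightarrow> 0"
proof (induction k)
  case (Suc k)
  have "(\<lambda>i. fdiff k f (Suc i) - fdiff k f i) \<longlonglongrightarrow> 0 - 0"
    using Suc.IH by (intro tendsto_diff LIMSEQ_Suc)
  then show ?case by simp
qed (simp add: assms)

text \<open>If \<open>f\<close> is monotone of order n+1, then \<open>(-1) ^ n * fdiff n f\<close>
  is nonincreasing; as it tends to 0, it is nonnegative. Descending from \<open>k\<close>, this
  makes the weights at every stage of the repeated summation by parts nonnegative.\<close>

lemma k_monotone_lower: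
  assumes "k_monotone k f" "f \<longlonglongrightarrow> 0" "l \<le> k"
  shows "k_monotone l f"
  using assms(3,1)
proof (induction l rule: inc_induct)
  case (step n)
  let ?d = "\<lambda>i. (-1) ^ n * fdiff n f i"
  have "decseq ?d"
    using step by (intro decseq_SucI) (auto simp: k_monotone_def algebra_simps)
  moreover have "?d \<longlonglongrightarrow> (-1) ^ n * 0"
    by (intro tendsto_intros fdiff_tendsto_0 assms)
  ultimately show ?case
    unfolding k_monotone_def using decseq_ge[of ?d 0] by simp
qed

text \<open>Pascal's rule for \<open>i < j\<close>, and 1 - 0 = 1 at \<open>i = j\<close>. It lowers
  the order of a spline down to 1, where the spline is the nonincreasing indicator of
  \<open>i <= j\<close>.\<close>

lemma spline_diff:
  "spline (Suc (Suc k)) j i - spline (Suc (Suc k)) j (Suc i) = spline (Suc k) j i"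
proof (cases "i < j")
  case True
  then obtain d where "j = Suc (i + d)"
    using less_imp_Suc_add by blast
  then show ?thesis by (simp add: spline_def)
qed (auto simp: spline_def)

lemma k_monotone_spline: "k_monotone (Suc k) (spline (Suc k) j)"
proof (induction k)
  case 0
  then show ?case by (simp add: k_monotone_def spline_def)
next
  case (Suc k)
  then show ?case by (subst k_monotone_Suc) (simp add: spline_diff)
qed

lemma spline_nonneg: "0 \<le> spline k j i"
  by (simp add: spline_def)

text \<open>Splines are the kernel of iterated summation: an induction on the order, then on
  \<open>l\<close>, matches the recursion of the primitives with Pascal's rule in the knot
  index.\<close>

lemma iter_prim_eq_sum:
  "iter_prim (Suc k) g l = (\<Sum>i\<le>l. spline (Suc k) l i * g i)"
proof (induction k arbitrary: l)
  case 0
  then show ?case by (simp add: spline_def atLeast0AtMost)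
next
  case (Suc k)
  have *: "spline (Suc (Suc k)) (Suc l) i = spline (Suc (Suc k)) l i + spline (Suc k) (Suc l) i"
    if "i \<le> Suc l" for l i
    using that by (cases "i = Suc l") (auto simp: spline_def Suc_diff_le)
  note IH = Suc.IH
  show ?case
  proof (induction l)
    case 0
    show ?case using IH[of 0] by (simp add: spline_def)
  next
    case (Suc l)
    have "iter_prim (Suc (Suc k)) g (Suc l) =
        (\<Sum>i\<le>l. spline (Suc (Suc k)) l i * g i) + iter_prim (Suc k) g (Suc l)"
      unfolding Suc.IH[symmetric] iter_prim.simps(2)[of "Suc k"] by (rule sum.atLeast0_atMost_Suc)
    also have "(\<Sum>i\<le>l. spline (Suc (Suc k)) l i * g i) =
        (\<Sum>i\<le>Suc l. spline (Suc (Suc k)) l i * g i)"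
      by (simp add: spline_def)
    finally show ?case
      unfolding IH sum.distrib[symmetric]
      by (auto intro!: sum.cong simp: * algebra_simps)
  qed
qed

lemma spline_sums:
  "(\<lambda>i. spline (Suc k) l i * g i) sums iter_prim (Suc k) g l"
  unfolding iter_prim_eq_sum by (rule sums_finite) (auto simp: spline_def)

text \<open>Treating masses as primitives of the constant 1 lets the pairing identity below evaluate
  mixtures of spline masses too.\<close>

lemma spline_mass_eq: "spline_mass (Suc k) l = iter_prim (Suc k) (\<lambda>_. 1) l"
  by (simp add: spline_mass_def iter_prim_eq_sum atLeast0AtMost del: iter_prim.simps)

lemma spline_sums_mass: "spline (Suc k) l sums spline_mass (Suc k) l"
  using spline_sums[of k l "\<lambda>_. 1"] by (simp add: spline_mass_eq)

lemma spline_mass_pos: "0 < spline_mass (Suc k) l"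
  unfolding spline_mass_def
  by (rule sum_pos2[of _ 0]) (auto simp: spline_def)

lemma iter_prim_one_nonneg: "0 \<le> iter_prim k (\<lambda>_. 1) l"
  by (induction k arbitrary: l) (auto intro: sum_nonneg)

lemma iter_prim_diff:
  "iter_prim k (\<lambda>i. f i - g i) l = iter_prim k f l - iter_prim k g l"
  by (induction k arbitrary: l) (simp_all add: sum_subtractf)

text \<open>Iterated summation is linear and positive, so boundary terms of a signed sequence are
  dominated by those of the constant 1.\<close>

lemma iter_prim_bound:
  assumes "\<And>i. \<bar>r i\<bar> \<le> B"
  shows "\<bar>iter_prim k r l\<bar> \<le> B * iter_prim k (\<lambda>_. 1) l"
proof (induction k arbitrary: l)
  case (Suc k)
  have "\<bar>iter_prim (Suc k) r l\<bar> \<le> (\<Sum>i=0..l. \<bar>iter_prim k r i\<bar>)"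
    by simp
  also have "\<dots> \<le> (\<Sum>i=0..l. B * iter_prim k (\<lambda>_. 1) i)"
    by (intro sum_mono Suc)
  finally show ?case by (simp add: sum_distrib_left)
qed (simp add: assms)

section \<open>Spline decomposition by repeated summation by parts\<close>

lemma abel_step:
  fixes d R :: "nat \<Rightarrow> real"
  shows "(\<Sum>j\<le>N. (d j - d (Suc j)) * (\<Sum>i=0..j. R i)) =
    (\<Sum>j\<le>N. d j * R j) - d (Suc N) * (\<Sum>i=0..N. R i)"
  by (induction N) (simp_all add: algebra_simps)

text \<open>Dominated convergence: the \<open>j\<close>-th summand of \<open>d (Suc N) * (\<Sum>j\<le>N. R j)\<close> is at most
  \<open>d j * R j\<close> and vanishes as \<open>N\<close> grows.\<close>
lemma boundary_term_tendsto_0: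
  fixes d R :: "nat \<Rightarrow> real"
  assumes dec: "decseq d" and lim: "d \<longlonglongrightarrow> 0" and R: "\<And>j. 0 \<le> R j"
    and sm: "summable (\<lambda>j. d j * R j)"
  shows "(\<lambda>N. d (Suc N) * (\<Sum>i=0..N. R i)) \<longlonglongrightarrow> 0"
proof (rule LIMSEQ_I)
  fix e :: real assume e: "0 < e"
  have d0: "0 \<le> d i" for i using decseq_ge[OF dec lim] .
  obtain M where M: "\<And>m n. M \<le> m \<Longrightarrow> norm (\<Sum>j=m..<n. d j * R j) < e / 2"
    using sm e unfolding summable_Cauchy by (metis half_gt_zero)
  have "(\<lambda>N. d (Suc N) * (\<Sum>i=0..<M. R i)) \<longlonglongrightarrow> 0 * (\<Sum>i=0..<M. R i)"
    by (intro tendsto_intros LIMSEQ_Suc lim)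
  then have "\<forall>\<^sub>F N in sequentially. d (Suc N) * (\<Sum>i=0..<M. R i) < e / 2"
    using e by (intro order_tendstoD) auto
  then obtain K where K: "\<And>N. K \<le> N \<Longrightarrow> d (Suc N) * (\<Sum>i=0..<M. R i) < e / 2"
    unfolding eventually_sequentially by blast
  show "\<exists>no. \<forall>n\<ge>no. norm (d (Suc n) * (\<Sum>i=0..n. R i) - 0) < e"
  proof (intro exI allI impI)
    fix N assume N: "max K M \<le> N"
    have "(\<Sum>i=0..N. R i) = (\<Sum>i=0..<M. R i) + (\<Sum>i=M..<Suc N. R i)"
      using N by (subst sum.atLeastLessThan_concat) (auto simp: atLeastLessThanSuc_atLeastAtMost)
    moreover have "d (Suc N) * (\<Sum>i=M..<Suc N. R i) \<le> (\<Sum>i=M..<Suc N. d i * R i)"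
      unfolding sum_distrib_left
      by (intro sum_mono mult_right_mono R decseqD[OF dec]) auto
    moreover have "(\<Sum>i=M..<Suc N. d i * R i) < e / 2"
      using M[of M "Suc N"] by simp
    ultimately have "d (Suc N) * (\<Sum>i=0..N. R i) < e"
      using K[of N] N by (simp add: distrib_left)
    moreover have "0 \<le> d (Suc N) * (\<Sum>i=0..N. R i)"
      by (intro mult_nonneg_nonneg d0 sum_nonneg R)
    ultimately show "norm (d (Suc N) * (\<Sum>i=0..N. R i) - 0) < e"
      by simp
  qed
qed

text \<open>\<open>k\<close> summations by parts, each moving a difference onto \<open>f\<close> and
  a summation onto \<open>r\<close>; the total is unchanged because the boundary terms
  vanish.\<close>

lemma iter_prim_pairing_sums:
  assumes mono: "k_monotone k f" and f0: "\<And>i. 0 \<le> f i" and fs: "summable f"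
    and r: "\<And>i. \<bar>r i\<bar> \<le> B"
  shows "(\<lambda>j. (-1) ^ k * fdiff k f j * iter_prim k r j) sums (\<Sum>i. f i * r i)"
proof -
  define d where "d l i = (-1) ^ l * fdiff l f i" for l i
  have lim: "d l \<longlonglongrightarrow> 0" for l
    using tendsto_mult[OF tendsto_const fdiff_tendsto_0[OF summable_LIMSEQ_zero[OF fs], of l]]
    unfolding d_def by simp
  have d_Suc: "d (Suc l) i = d l i - d l (Suc i)" for l i
    by (simp add: d_def algebra_simps)
  have d0: "0 \<le> d l i" if "l \<le> k" for l i
    using k_monotone_lower[OF mono summable_LIMSEQ_zero[OF fs] that]
    by (simp add: k_monotone_def d_def)
  \<comment> \<open>The constant 1 is carried along: its terms are nonnegative, and their
    summability at level \<open>l\<close> makes the boundary terms vanish for 1 and, by domination,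
    for the signed \<open>r\<close>.\<close>
  have "(\<lambda>j. d l j * iter_prim l (\<lambda>_. 1) j) sums (\<Sum>i. f i) \<and>
      (\<lambda>j. d l j * iter_prim l r j) sums (\<Sum>i. f i * r i)" if "l \<le> k" for l
    using that
  proof (induction l)
    case 0
    have "summable (\<lambda>i. f i * r i)"
    proof (rule summable_comparison_test')
      show "summable (\<lambda>i. f i * B)" using fs by (rule summable_mult2)
      show "norm (f i * r i) \<le> f i * B" for i
        using f0[of i] r[of i] by (simp add: abs_mult mult_left_mono)
    qed
    then show ?case using fs by (simp add: d_def summable_sums)
  next
    case (Suc l)
    let ?one = "\<lambda>_. 1 :: real"
    have dec: "decseq (d l)"
      using d0[OF Suc.prems] by (intro decseq_SucI) (auto simp: d_Suc)
    have bdry: "(\<lambda>N. d l (Suc N) * (\<Sum>i=0..N. iter_prim l ?one i)) \<longlonglongrightarrow> 0"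
      using Suc by (intro boundary_term_tendsto_0 dec lim iter_prim_one_nonneg)
        (auto simp: sums_iff)
    have step: "(\<lambda>j. d (Suc l) j * iter_prim (Suc l) s j) sums c"
      if s: "(\<lambda>j. d l j * iter_prim l s j) sums c" and b: "\<And>i. \<bar>s i\<bar> \<le> A" for s c A
    proof -
      have "(\<lambda>N. d l (Suc N) * (\<Sum>i=0..N. iter_prim l s i)) \<longlonglongrightarrow> 0"
      proof (rule Lim_null_comparison)
        show "(\<lambda>N. A * (d l (Suc N) * (\<Sum>i=0..N. iter_prim l ?one i))) \<longlonglongrightarrow> 0"
          using tendsto_mult_right_zero[OF bdry] by simp
        show "\<forall>\<^sub>F N in sequentially. norm (d l (Suc N) * (\<Sum>i=0..N. iter_prim l s i))
            \<le> A * (d l (Suc N) * (\<Sum>i=0..N. iter_prim l ?one i))"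
        proof (rule always_eventually, rule allI)
          fix N
          show "norm (d l (Suc N) * (\<Sum>i=0..N. iter_prim l s i))
            \<le> A * (d l (Suc N) * (\<Sum>i=0..N. iter_prim l ?one i))"
            using mult_left_mono[OF iter_prim_bound[of s A "Suc l" N, OF b] d0[of l "Suc N"]] Suc.prems
              d0[of l "Suc N"]
            by (simp add: abs_mult ac_simps)
        qed
      qed
      then have "(\<lambda>N. (\<Sum>j\<le>N. d l j * iter_prim l s j) - d l (Suc N) * (\<Sum>i=0..N. iter_prim l s i))
          \<longlonglongrightarrow> c - 0"
        using s by (intro tendsto_diff) (simp_all add: sums_def_le)
      then show ?thesis
        unfolding sums_def_le by (simp add: d_Suc abel_step)
    qed
    show ?case
      using Suc step[of ?one _ 1] step[OF _ r] by simp
  qed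
  from this[of k] show ?thesis by (simp add: d_def)
qed

section \<open>Square-summable sequences\<close>

lemma summable_mult_of_squares:
  fixes a b :: "nat \<Rightarrow> real"
  assumes "summable (\<lambda>i. (a i)\<^sup>2)" "summable (\<lambda>i. (b i)\<^sup>2)"
  shows "summable (\<lambda>i. a i * b i)"
proof (rule summable_comparison_test')
  show "summable (\<lambda>i. (a i)\<^sup>2 + (b i)\<^sup>2)" using assms by (rule summable_add)
  show "norm (a i * b i) \<le> (a i)\<^sup>2 + (b i)\<^sup>2" for i
    using sum_squares_bound[of "\<bar>a i\<bar>" "\<bar>b i\<bar>"]
      mult_nonneg_nonneg[of "\<bar>a i\<bar>" "\<bar>b i\<bar>"]
    unfolding real_norm_def abs_mult power2_abs by linarith
qed

lemma l2_sums_lin: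
  fixes a b :: "nat \<Rightarrow> real"
  assumes a: "summable (\<lambda>i. (a i)\<^sup>2)" and b: "summable (\<lambda>i. (b i)\<^sup>2)"
  shows "(\<lambda>i. (s * a i + t * b i)\<^sup>2) sums
    (s\<^sup>2 * l2_norm_sq a + 2 * s * t * (\<Sum>i. a i * b i) + t\<^sup>2 * l2_norm_sq b)"
proof -
  note ab = summable_mult_of_squares[OF a b]
  have "(\<lambda>i. s\<^sup>2 * (a i)\<^sup>2 + 2 * s * t * (a i * b i) + t\<^sup>2 * (b i)\<^sup>2) sums
    (s\<^sup>2 * l2_norm_sq a + 2 * s * t * (\<Sum>i. a i * b i) + t\<^sup>2 * l2_norm_sq b)"
    unfolding l2_norm_sq_def using a b ab
    by (intro sums_add sums_mult summable_sums)
  moreover have "s\<^sup>2 * (a i)\<^sup>2 + 2 * s * t * (a i * b i) + t\<^sup>2 * (b i)\<^sup>2 = (s * a i + t * b i)\<^sup>2" for i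
    by (simp add: power2_sum power_mult_distrib)
  ultimately show ?thesis by simp
qed

lemmas l2_lin = l2_sums_lin[THEN sums_unique, symmetric, folded l2_norm_sq_def]
lemmas summable_sq_lin = l2_sums_lin[THEN sums_summable]

lemma l2_nonneg: "summable (\<lambda>i. (a i)\<^sup>2) \<Longrightarrow> 0 \<le> l2_norm_sq a"
  unfolding l2_norm_sq_def by (rule suminf_nonneg) auto

lemma l2_coord_le: "summable (\<lambda>i. (a i)\<^sup>2) \<Longrightarrow> (a i)\<^sup>2 \<le> l2_norm_sq a"
  unfolding l2_norm_sq_def using sum_le_suminf[of "\<lambda>i. (a i)\<^sup>2" "{i}"] by simp

lemma summable_sq_diff:
  fixes a b :: "nat \<Rightarrow> real"
  assumes "summable (\<lambda>i. (a i)\<^sup>2)" "summable (\<lambda>i. (b i)\<^sup>2)"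
  shows "summable (\<lambda>i. (a i - b i)\<^sup>2)"
  using summable_sq_lin[OF assms, of 1 "-1"] by simp

lemma summable_sq_of_nonneg:
  fixes f :: "nat \<Rightarrow> real"
  assumes "summable f" "\<And>i. 0 \<le> f i"
  shows "summable (\<lambda>i. (f i)\<^sup>2)"
proof -
  have "bounded (range f)"
    using summable_LIMSEQ_zero[OF assms(1)] by (meson convergent_imp_bounded)
  then obtain B where B: "\<And>i. \<bar>f i\<bar> \<le> B"
    by (auto simp: bounded_iff)
  show ?thesis
  proof (rule summable_comparison_test')
    show "summable (\<lambda>i. B * f i)" using assms(1) by (rule summable_mult)
    show "norm ((f i)\<^sup>2) \<le> B * f i" for i
      using assms(2)[of i] B[of i] by (simp add: power2_eq_square mult_right_mono)
  qed
qed

text \<open>First-order optimality: with a negative inner product, the linear term in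
  \<open>e\<close> would beat the quadratic one for small \<open>e\<close>.\<close>

lemma nonneg_of_perturbation:
  fixes u h :: "nat \<Rightarrow> real"
  assumes u: "summable (\<lambda>i. (u i)\<^sup>2)" and h: "summable (\<lambda>i. (h i)\<^sup>2)" and "0 < e0"
    and min: "\<And>e. 0 < e \<Longrightarrow> e \<le> e0 \<Longrightarrow> l2_norm_sq u \<le> l2_norm_sq (\<lambda>i. u i + e * h i)"
  shows "0 \<le> (\<Sum>i. u i * h i)"
proof (rule ccontr)
  let ?c = "\<Sum>i. u i * h i"
  assume neg: "\<not> 0 \<le> ?c"
  \<comment> \<open>The summand 1 keeps \<open>H\<close> positive when \<open>h\<close> vanishes.
    The step \<open>- ?c / H\<close> then lets the quadratic term cancel at most half of the linear
    one, and \<open>e0\<close> caps it.\<close>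
  define H where "H = l2_norm_sq h + 1"
  have H: "0 < H" using l2_nonneg[OF h] by (simp add: H_def)
  define e where "e = min e0 (- ?c / H)"
  have e: "0 < e" "e \<le> e0" "e * H \<le> - ?c"
    using neg H \<open>0 < e0\<close> by (auto simp: e_def min_def field_simps)
  have "0 \<le> 2 * e * ?c + e\<^sup>2 * l2_norm_sq h"
    using min[OF e(1,2)] l2_lin[OF u h, of 1 e] by simp
  also have "\<dots> \<le> e * (2 * ?c + e * H)"
    using e(1) by (simp add: power2_eq_square H_def algebra_simps)
  also have "\<dots> \<le> e * ?c"
    using e by (intro mult_left_mono) auto
  also have "\<dots> < 0" using e(1) neg by (simp add: mult_pos_neg)
  finally show False by simp
qed

section \<open>Monotone probabilities and subprobabilities\<close>

text \<open>Bounding partial sums forces summability with mass at most 1 and passes directly to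
  pointwise limits.\<close>

definition k_monotone_subprobs :: "nat \<Rightarrow> (nat \<Rightarrow> real) set" where
  "k_monotone_subprobs k = {f. k_monotone k f \<and> (\<forall>i. 0 \<le> f i) \<and> (\<forall>N. (\<Sum>i<N. f i) \<le> 1)}"

lemma k_monotone_probs_iff:
  "f \<in> k_monotone_probs k \<longleftrightarrow> k_monotone k f \<and> (\<forall>i. 0 \<le> f i) \<and> f sums 1"
proof (intro iffI conjI allI)
  assume "f \<in> k_monotone_probs k"
  then obtain P where P: "f = pmf P" and m: "k_monotone k f"
    by (auto simp: k_monotone_probs_def)
  show "k_monotone k f" by fact
  show "0 \<le> f i" for i by (simp add: P)
  show "f sums 1"
    using sums_infsetsum_nat'[OF pmf_abs_summable, of P] by (simp add: P infsetsum_pmf_eq_1)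
next
  assume *: "k_monotone k f \<and> (\<forall>i. 0 \<le> f i) \<and> f sums 1"
  then have "(\<integral>\<^sup>+ i. ennreal (f i) \<partial>count_space UNIV) = 1"
    by (simp add: nn_integral_count_space_nat suminf_ennreal2 sums_iff)
  then have "f = pmf (embed_pmf f)"
    using * by (simp add: pmf_embed_pmf fun_eq_iff)
  with * show "f \<in> k_monotone_probs k"
    unfolding k_monotone_probs_def by blast
qed

lemma subprobs_summable: "f \<in> k_monotone_subprobs k \<Longrightarrow> summable f"
  unfolding k_monotone_subprobs_def by (auto intro!: summableI_nonneg_bounded)

lemma subprobs_iff:
  "f \<in> k_monotone_subprobs k \<longleftrightarrow>
    k_monotone k f \<and> (\<forall>i. 0 \<le> f i) \<and> summable f \<and> suminf f \<le> 1"
  using subprobs_summable[of f k]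
  by (auto simp: k_monotone_subprobs_def intro: suminf_le_const order_trans[OF sum_le_suminf])

lemma probs_subset_subprobs: "k_monotone_probs k \<subseteq> k_monotone_subprobs k"
  by (auto simp: subprobs_iff k_monotone_probs_iff sums_iff)

lemma subprobs_summable_sq: "f \<in> k_monotone_subprobs k \<Longrightarrow> summable (\<lambda>i. (f i)\<^sup>2)"
  by (intro summable_sq_of_nonneg) (auto simp: subprobs_iff)

lemma subprobs_convex:
  assumes "f \<in> k_monotone_subprobs k" "g \<in> k_monotone_subprobs k" "0 \<le> a" "0 \<le> b" "a + b = 1"
  shows "(\<lambda>i. a * f i + b * g i) \<in> k_monotone_subprobs k"
proof -
  have "(\<Sum>i<N. a * f i + b * g i) \<le> 1" for N
  proof -
    have "(\<Sum>i<N. a * f i + b * g i) = a * (\<Sum>i<N. f i) + b * (\<Sum>i<N. g i)"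
      by (simp add: sum.distrib sum_distrib_left)
    also have "\<dots> \<le> a * 1 + b * 1"
      using assms by (intro add_mono mult_left_mono) (auto simp: k_monotone_subprobs_def)
    finally show ?thesis using assms by simp
  qed
  then show ?thesis
    using assms by (auto simp: k_monotone_subprobs_def intro: k_monotone_lin)
qed

lemma probs_convex:
  assumes "f \<in> k_monotone_probs k" "g \<in> k_monotone_probs k" "0 \<le> a" "0 \<le> b" "a + b = 1"
  shows "(\<lambda>i. a * f i + b * g i) \<in> k_monotone_probs k"
proof -
  have "(\<lambda>i. a * f i + b * g i) sums (a * 1 + b * 1)"
    using assms by (intro sums_add sums_mult) (auto simp: k_monotone_probs_iff)
  then show ?thesis
    using assms by (auto simp: k_monotone_probs_iff intro: k_monotone_lin)
qed

lemma normalized_spline_probs: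
  "(\<lambda>i. spline (Suc k) l i / spline_mass (Suc k) l) \<in> k_monotone_probs (Suc k)"
proof -
  let ?m = "spline_mass (Suc k) l"
  have "k_monotone (Suc k) (\<lambda>i. (1 / ?m) * spline (Suc k) l i + 0 * spline (Suc k) l i)"
    using spline_mass_pos[of k l] by (intro k_monotone_lin k_monotone_spline) auto
  moreover have "(\<lambda>i. spline (Suc k) l i / ?m) sums (?m / ?m)"
    by (intro sums_divide spline_sums_mass)
  ultimately show ?thesis
    using spline_mass_pos[of k l] by (simp add: k_monotone_probs_iff spline_nonneg)
qed

section \<open>Variational characterisation\<close>

text \<open>From here on the argument is deterministic, with \<open>q\<close> one realised empirical
  mass function. Finite support gives square summability and later lets a limit pass through the sum
  over the support.\<close>

context
  fixes q :: "nat \<Rightarrow> real"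
  assumes q_fin: "finite {i. q i \<noteq> 0}" and q_sums: "q sums 1"
begin

lemma q_summable_sq: "summable (\<lambda>i. (q i)\<^sup>2)"
  by (rule summable_finite[OF q_fin]) auto

lemma subprobs_residual_summable_sq:
  "f \<in> k_monotone_subprobs k \<Longrightarrow> summable (\<lambda>i. (f i - q i)\<^sup>2)"
  by (intro summable_sq_diff subprobs_summable_sq q_summable_sq)

lemma residual_bounded:
  assumes "f \<in> k_monotone_subprobs k"
  obtains B where "\<And>i. \<bar>f i - q i\<bar> \<le> B"
proof -
  have "(\<lambda>i. f i - q i) \<longlonglongrightarrow> 0 - 0"
    using subprobs_summable[OF assms] sums_summable[OF q_sums]
    by (intro tendsto_diff summable_LIMSEQ_zero)
  then have "bounded (range (\<lambda>i. f i - q i))"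
    by (rule convergent_imp_bounded)
  then show ?thesis using that by (auto simp: bounded_iff)
qed

text \<open>The spline weights of \<open>g\<close> are paired with the slack in condition (1).
  Arbitrary \<open>g\<close> yields the variational inequality, \<open>g = f\<close> the equality at
  knots.\<close>

lemma residual_pairing_sums:
  assumes f: "f \<in> k_monotone_subprobs (Suc k)" and g: "g \<in> k_monotone_probs (Suc k)"
  shows "(\<lambda>j. (-1) ^ Suc k * fdiff (Suc k) g j *
      (iter_prim (Suc k) f j - iter_prim (Suc k) q j - c * spline_mass (Suc k) j))
    sums ((\<Sum>i. g i * (f i - q i)) - c)"
proof -
  obtain B where B: "\<And>i. \<bar>f i - q i\<bar> \<le> B"
    using residual_bounded[OF f] by blast
  have g': "k_monotone (Suc k) g" "\<And>i. 0 \<le> g i" "summable g" "suminf g = 1"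
    using g by (auto simp: k_monotone_probs_iff sums_iff)
  define w where "w j = (-1) ^ Suc k * fdiff (Suc k) g j" for j
  have "(\<lambda>j. w j * iter_prim (Suc k) (\<lambda>i. f i - q i) j) sums (\<Sum>i. g i * (f i - q i))"
    unfolding w_def by (rule iter_prim_pairing_sums[OF g'(1-3) B])
  \<comment> \<open>Pairing with the constant 1 returns the mass of \<open>g\<close>, which is 1, so
    \<open>c\<close> comes out unchanged.\<close>
  moreover have "(\<lambda>j. w j * spline_mass (Suc k) j) sums (\<Sum>i. g i * 1)"
    unfolding w_def spline_mass_eq
    by (rule iter_prim_pairing_sums[OF g'(1-3), of _ 1]) simp
  then have "(\<lambda>j. c * (w j * spline_mass (Suc k) j)) sums (c * 1)"
    using g'(4) by (intro sums_mult) simp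
  ultimately have "(\<lambda>j. w j * iter_prim (Suc k) (\<lambda>i. f i - q i) j - c * (w j * spline_mass (Suc k) j))
      sums ((\<Sum>i. g i * (f i - q i)) - c * 1)"
    by (rule sums_diff)
  then show ?thesis
    unfolding w_def[symmetric] iter_prim_diff
    by (simp only: right_diff_distrib mult.left_commute[of "w _" c] mult_1_right)
qed

lemma conditions_imp_variational:
  assumes f: "f \<in> k_monotone_subprobs (Suc k)" and g: "g \<in> k_monotone_probs (Suc k)"
    and cond: "\<And>l. iter_prim (Suc k) f l - iter_prim (Suc k) q l \<ge> c * spline_mass (Suc k) l"
  shows "c \<le> (\<Sum>i. g i * (f i - q i))"
proof -
  have w: "0 \<le> (-1) ^ Suc k * fdiff (Suc k) g j" for j
    using g unfolding k_monotone_probs_iff k_monotone_def by blast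
  have "0 \<le> (\<Sum>i. g i * (f i - q i)) - c"
  proof (rule sums_le[OF _ sums_zero residual_pairing_sums[OF f g, of c]])
    show "0 \<le> (-1) ^ Suc k * fdiff (Suc k) g j *
      (iter_prim (Suc k) f j - iter_prim (Suc k) q j - c * spline_mass (Suc k) j)" for j
      using cond[of j] by (intro mult_nonneg_nonneg[OF w]) linarith
  qed
  then show ?thesis by linarith
qed

text \<open>Expand the square of \<open>g - q\<close> written as \<open>(f - q) + (g - f)\<close>;
  the cross term is the variational expression at \<open>f\<close>.\<close>

lemma l2_decomposition:
  assumes f: "f \<in> k_monotone_probs k" and g: "g \<in> k_monotone_probs k"
  shows "l2_norm_sq (\<lambda>i. g i - q i) = l2_norm_sq (\<lambda>i. f i - q i)
    + 2 * ((\<Sum>i. g i * (f i - q i)) - beta q f) + l2_norm_sq (\<lambda>i. g i - f i)"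
proof -
  have fs: "f \<in> k_monotone_subprobs k" and gs: "g \<in> k_monotone_subprobs k"
    using f g probs_subset_subprobs by auto
  note r = subprobs_residual_summable_sq[OF fs]
  note gr = summable_mult_of_squares[OF subprobs_summable_sq[OF gs] r]
  note fr = summable_mult_of_squares[OF subprobs_summable_sq[OF fs] r]
  have "(\<Sum>i. (f i - q i) * (g i - f i)) = (\<Sum>i. g i * (f i - q i) - f i * (f i - q i))"
    by (intro suminf_cong) (simp add: algebra_simps)
  also have "\<dots> = (\<Sum>i. g i * (f i - q i)) - beta q f"
    unfolding beta_def by (rule suminf_diff[symmetric, OF gr fr])
  finally show ?thesis
    using l2_lin[OF r summable_sq_diff[OF subprobs_summable_sq[OF gs] subprobs_summable_sq[OF fs]], of 1 1]
    by simp
qed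

text \<open>In \<open>l2_decomposition\<close> the cross term is nonnegative by the variational
  inequality and the last term is positive. Strictness gives uniqueness.\<close>

lemma conditions_imp_strict_min:
  assumes f: "f \<in> k_monotone_probs (Suc k)" and g: "g \<in> k_monotone_probs (Suc k)"
    and cond: "\<And>l. iter_prim (Suc k) f l - iter_prim (Suc k) q l \<ge> beta q f * spline_mass (Suc k) l"
    and ne: "g \<noteq> f"
  shows "l2_norm_sq (\<lambda>i. f i - q i) < l2_norm_sq (\<lambda>i. g i - q i)"
proof -
  have fs: "f \<in> k_monotone_subprobs (Suc k)" and gs: "g \<in> k_monotone_subprobs (Suc k)"
    using f g probs_subset_subprobs by auto
  obtain i where "g i \<noteq> f i" using ne by auto
  then have "0 < (g i - f i)\<^sup>2" by simp
  also have "\<dots> \<le> l2_norm_sq (\<lambda>i. g i - f i)"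
    by (intro l2_coord_le summable_sq_diff subprobs_summable_sq[OF gs] subprobs_summable_sq[OF fs])
  finally show ?thesis
    using l2_decomposition[OF f g] conditions_imp_variational[OF fs g cond] by simp
qed

text \<open>Moving from \<open>f\<close> towards a normalised spline cannot decrease the distance to
  \<open>q\<close>, which is condition (1). At knots, a series of nonnegative terms with sum 0 has
  only zero terms, and the weight at a knot is positive.\<close>

lemma min_imp_conditions:
  assumes f: "f \<in> k_monotone_probs (Suc k)"
    and min: "\<And>g. g \<in> k_monotone_probs (Suc k) \<Longrightarrow>
      l2_norm_sq (\<lambda>i. f i - q i) \<le> l2_norm_sq (\<lambda>i. g i - q i)"
  shows "iter_prim (Suc k) f l - iter_prim (Suc k) q l \<ge> beta q f * spline_mass (Suc k) l"
    and "k_knot (Suc k) f l \<Longrightarrow>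
      iter_prim (Suc k) f l - iter_prim (Suc k) q l = beta q f * spline_mass (Suc k) l"
proof -
  have fs: "f \<in> k_monotone_subprobs (Suc k)"
    using f probs_subset_subprobs by auto
  note r = subprobs_residual_summable_sq[OF fs]
  note fr = summable_mult_of_squares[OF subprobs_summable_sq[OF fs] r]
  show cond: "iter_prim (Suc k) f l - iter_prim (Suc k) q l \<ge> beta q f * spline_mass (Suc k) l" for l
  proof -
    let ?m = "spline_mass (Suc k) l"
    define h where "h = (\<lambda>i. spline (Suc k) l i / ?m)"
    have h: "h \<in> k_monotone_probs (Suc k)"
      unfolding h_def by (rule normalized_spline_probs)
    then have hs: "h \<in> k_monotone_subprobs (Suc k)"
      using probs_subset_subprobs by auto
    have "0 \<le> (\<Sum>i. (f i - q i) * (h i - f i))"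
    proof (rule nonneg_of_perturbation[OF r _ zero_less_one])
      show "summable (\<lambda>i. (h i - f i)\<^sup>2)"
        by (intro summable_sq_diff subprobs_summable_sq[OF hs] subprobs_summable_sq[OF fs])
      fix e :: real assume e: "0 < e" "e \<le> 1"
      have "(\<lambda>i. (1 - e) * f i + e * h i) \<in> k_monotone_probs (Suc k)"
        using e by (intro probs_convex f h) auto
      from min[OF this]
      show "l2_norm_sq (\<lambda>i. f i - q i) \<le> l2_norm_sq (\<lambda>i. f i - q i + e * (h i - f i))"
        by (simp add: algebra_simps)
    qed
    also have "\<dots> = (\<Sum>i. h i * (f i - q i) - f i * (f i - q i))"
      by (intro suminf_cong) (simp add: algebra_simps)
    also have "\<dots> = (\<Sum>i. h i * (f i - q i)) - beta q f"
      unfolding beta_def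
      by (rule suminf_diff[symmetric, OF summable_mult_of_squares[OF subprobs_summable_sq[OF hs] r] fr])
    also have "(\<Sum>i. h i * (f i - q i)) = iter_prim (Suc k) (\<lambda>i. f i - q i) l / ?m"
      using sums_divide[OF spline_sums[of k l "\<lambda>i. f i - q i"], of ?m]
      by (simp add: h_def sums_iff del: iter_prim.simps)
    finally show ?thesis
      using spline_mass_pos[of k l] by (simp add: iter_prim_diff field_simps del: iter_prim.simps)
  qed
  assume knot: "k_knot (Suc k) f l"
  define t where "t j = (-1) ^ Suc k * fdiff (Suc k) f j *
    (iter_prim (Suc k) f j - iter_prim (Suc k) q j - beta q f * spline_mass (Suc k) j)" for j
  \<comment> \<open>With \<open>g = f\<close> the pairing equals \<open>beta q f\<close>, so
    subtracting that constant leaves 0.\<close>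
  have "t sums 0"
    using residual_pairing_sums[OF fs f, of "beta q f"] unfolding t_def beta_def by simp
  moreover have "0 \<le> t j" for j
  proof -
    have "0 \<le> (-1) ^ Suc k * fdiff (Suc k) f j"
      using f unfolding k_monotone_probs_iff k_monotone_def by blast
    then show ?thesis
      unfolding t_def by (rule mult_nonneg_nonneg) (use cond[of j] in linarith)
  qed
  ultimately have "t l = 0"
    using suminf_eq_zero_iff[of t] unfolding sums_iff by metis
  moreover have "(-1) ^ Suc k * fdiff (Suc k) f l \<noteq> 0"
    using knot unfolding k_knot_def by linarith
  ultimately have "iter_prim (Suc k) f l - iter_prim (Suc k) q l - beta q f * spline_mass (Suc k) l = 0"
    unfolding t_def by (metis mult_eq_0_iff)
  then show "iter_prim (Suc k) f l - iter_prim (Suc k) q l = beta q f * spline_mass (Suc k) l"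
    by linarith
qed

section \<open>Existence of the minimiser\<close>

text \<open>Coordinatewise convergence of a minimising sequence suffices: the constraints survive
  pointwise limits, and bounding finite partial sums shows that the objective cannot jump up in the
  limit.\<close>

lemma exists_min_subprobs:
  "\<exists>g\<in>k_monotone_subprobs k. \<forall>f\<in>k_monotone_subprobs k.
    l2_norm_sq (\<lambda>i. g i - q i) \<le> l2_norm_sq (\<lambda>i. f i - q i)"
proof -
  let ?C = "k_monotone_subprobs k"
  define D where "D f = l2_norm_sq (\<lambda>i. f i - q i)" for f
  define I where "I = Inf (D ` ?C)"
  have D0: "0 \<le> D f" if "f \<in> ?C" for f
    unfolding D_def by (intro l2_nonneg subprobs_residual_summable_sq[OF that])
  have bdd: "bdd_below (D ` ?C)" using D0 by (intro bdd_belowI[of _ 0]) auto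
  have I_le: "I \<le> D f" if "f \<in> ?C" for f
    unfolding I_def using that bdd by (intro cInf_lower) auto
  have "fdiff j (\<lambda>_. 0) i = 0" for j i by (induction j arbitrary: i) auto
  then have "(\<lambda>_. 0) \<in> ?C" by (simp add: k_monotone_subprobs_def k_monotone_def)
  then have "\<exists>f\<in>?C. D f < I + 1 / real (Suc n)" for n
    using cInf_lessD[of "D ` ?C" "I + 1 / real (Suc n)"] unfolding I_def by fastforce
  then obtain s where s: "\<And>n. s n \<in> ?C" and sD': "\<And>n. D (s n) < I + 1 / real (Suc n)"
    by metis
  define d where "d n = 1 / real (Suc n)" for n
  note sD = sD'[folded d_def]
  \<comment> \<open>Parallelogram law: the midpoint is feasible, so its value is at least
    \<open>I\<close>, while the values at \<open>s m\<close> and \<open>s n\<close> exceed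
    \<open>I\<close> by less than \<open>d m\<close> and \<open>d n\<close>.\<close>
  have close: "(s m i - s n i)\<^sup>2 \<le> 2 * d m + 2 * d n" for m n i
  proof -
    let ?a = "\<lambda>i. s m i - q i" and ?b = "\<lambda>i. s n i - q i"
    note a = subprobs_residual_summable_sq[OF s, of m] and b = subprobs_residual_summable_sq[OF s, of n]
    have "(\<lambda>i. 1/2 * s m i + 1/2 * s n i) \<in> ?C"
      by (rule subprobs_convex[OF s s]) auto
    then have "I \<le> D (\<lambda>i. 1/2 * s m i + 1/2 * s n i)"
      by (rule I_le)
    also have "D (\<lambda>i. 1/2 * s m i + 1/2 * s n i) = l2_norm_sq (\<lambda>i. 1/2 * ?a i + 1/2 * ?b i)"
      unfolding D_def by (rule arg_cong[of _ _ l2_norm_sq], rule ext) (simp add: field_simps)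
    finally have "I \<le> l2_norm_sq (\<lambda>i. 1/2 * ?a i + 1/2 * ?b i)" .
    then have "4 * I \<le> D (s m) + 2 * (\<Sum>i. ?a i * ?b i) + D (s n)"
      unfolding l2_lin[OF a b] D_def by (simp add: power2_eq_square)
    moreover have "l2_norm_sq (\<lambda>i. s m i - s n i) = D (s m) - 2 * (\<Sum>i. ?a i * ?b i) + D (s n)"
      using l2_lin[OF a b, of 1 "-1"] by (simp add: D_def)
    moreover have "(s m i - s n i)\<^sup>2 \<le> l2_norm_sq (\<lambda>i. s m i - s n i)"
      by (rule l2_coord_le[OF summable_sq_diff[OF subprobs_summable_sq[OF s] subprobs_summable_sq[OF s]]])
    ultimately show ?thesis using sD[of m] sD[of n] by linarith
  qed
  have "Cauchy (\<lambda>n. s n i)" for i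
  proof (rule metric_CauchyI)
    fix e :: real assume e: "0 < e"
    \<comment> \<open>The quarter matches the bound \<open>2 * d m + 2 * d n\<close>, where each of
      \<open>d m\<close> and \<open>d n\<close> is at most 1/(N+1).\<close>
    obtain N where N: "inverse (real (Suc N)) < e\<^sup>2 / 4"
      using reals_Archimedean[of "e\<^sup>2 / 4"] e by auto
    have "dist (s m i) (s n i) < e" if "N \<le> m" "N \<le> n" for m n
    proof -
      have "d m \<le> inverse (real (Suc N))" "d n \<le> inverse (real (Suc N))"
        using that unfolding d_def inverse_eq_divide by (auto intro!: frac_le)
      then have "(s m i - s n i)\<^sup>2 < e\<^sup>2"
        using close[of m i n] N by linarith
      then have "\<bar>s m i - s n i\<bar> < \<bar>e\<bar>"
        by (rule power2_less_imp_less[of "\<bar>_\<bar>" "\<bar>e\<bar>", unfolded power2_abs]) simp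
      then show ?thesis using e by (simp add: dist_real_def)
    qed
    then show "\<exists>M. \<forall>m\<ge>M. \<forall>n\<ge>M. dist (s m i) (s n i) < e" by blast
  qed
  then have g: "(\<lambda>n. s n i) \<longlonglongrightarrow> lim (\<lambda>n. s n i)" for i
    using Cauchy_convergent convergent_LIMSEQ_iff by blast
  define g where "g i = lim (\<lambda>n. s n i)" for i
  note g = g[folded g_def]
  have s': "0 \<le> (-1) ^ k * fdiff k (s n) i" "0 \<le> s n i" "(\<Sum>j<i. s n j) \<le> 1" for n i
    using s[of n] unfolding k_monotone_subprobs_def k_monotone_def by blast+
  have gC: "g \<in> ?C"
    unfolding k_monotone_subprobs_def k_monotone_def
  proof (intro CollectI conjI allI)
    fix i
    show "0 \<le> (-1) ^ k * fdiff k g i"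
      by (rule LIMSEQ_le_const[OF tendsto_mult[OF tendsto_const tendsto_fdiff[OF g]]])
        (use s' in blast)
    show "0 \<le> g i"
      by (rule LIMSEQ_le_const[OF g]) (use s' in blast)
    show "(\<Sum>j<i. g j) \<le> 1"
      by (rule LIMSEQ_le_const2[OF tendsto_sum[OF g]]) (use s' in blast)
  qed
  have "D g \<le> I"
    unfolding D_def l2_norm_sq_def
  proof (rule suminf_le_const[OF subprobs_residual_summable_sq[OF gC]])
    fix N
    have lim: "(\<lambda>n. \<Sum>i<N. (s n i - q i)\<^sup>2) \<longlonglongrightarrow> (\<Sum>i<N. (g i - q i)\<^sup>2)"
      by (intro tendsto_intros g)
    have lim': "(\<lambda>n. I + d n) \<longlonglongrightarrow> I + 0"
      unfolding d_def inverse_eq_divide[symmetric]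
      by (intro tendsto_add tendsto_const LIMSEQ_inverse_real_of_nat)
    have le: "(\<Sum>i<N. (s n i - q i)\<^sup>2) \<le> I + d n" for n
    proof -
      have "(\<Sum>i<N. (s n i - q i)\<^sup>2) \<le> D (s n)"
        unfolding D_def l2_norm_sq_def
        by (rule sum_le_suminf[OF subprobs_residual_summable_sq[OF s]]) auto
      then show ?thesis using sD[of n] by simp
    qed
    have "(\<Sum>i<N. (g i - q i)\<^sup>2) \<le> I + 0"
      by (rule LIMSEQ_le[OF lim lim']) (use le in blast)
    then show "(\<Sum>i<N. (g i - q i)\<^sup>2) \<le> I" by simp
  qed
  then show ?thesis
    using gC I_le order_trans unfolding D_def by blast
qed

section \<open>Flattening of splines and recovery of the full mass\<close>

lemma binomial_shift_ratio:
  "(\<lambda>t. real ((t + k) choose k) / real ((t + i + k) choose k)) \<longlonglongrightarrow> 1"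
proof (induction i)
  case (Suc i)
  \<comment> \<open>The absorption identity for binomial coefficients makes the ratio of
    neighbouring shifts equal to \<open>(t + i + 1) / (t + i + 1 + k)\<close>.\<close>
  have eq: "real ((t + i + k) choose k) * real (Suc (t + i) + k) =
      real (Suc (t + i)) * real ((t + Suc i + k) choose k)" for t
  proof -
    have "Suc (t + i) * (Suc (t + i + k) choose Suc (t + i)) =
        Suc (t + i + k) * ((t + i + k) choose (t + i))"
      by (rule Suc_times_binomial)
    moreover have "Suc (t + i + k) choose Suc (t + i) = (t + Suc i + k) choose k"
      by (subst binomial_symmetric) simp_all
    moreover have "(t + i + k) choose (t + i) = (t + i + k) choose k"
      by (subst binomial_symmetric) simp_all
    ultimately have "((t + i + k) choose k) * (Suc (t + i) + k) =
        Suc (t + i) * ((t + Suc i + k) choose k)"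
      by (simp only: mult.commute add_Suc)
    then show ?thesis by (metis of_nat_mult)
  qed
  have "real ((t + i + k) choose k) / real ((t + Suc i + k) choose k) =
      real (Suc (t + i)) / real (Suc (t + i) + k)" for t
    by (rule frac_eq_eq[THEN iffD2, OF _ _ eq]) simp_all
  \<comment> \<open>Telescoping: a shift by \<open>Suc i\<close> is a shift by \<open>i\<close>
    times one more factor tending to 1.\<close>
  moreover have "real ((t + k) choose k) / real ((t + Suc i + k) choose k) =
     (real ((t + k) choose k) / real ((t + i + k) choose k)) *
      (real ((t + i + k) choose k) / real ((t + Suc i + k) choose k))" for t
    by simp
  ultimately have "real ((t + k) choose k) / real ((t + Suc i + k) choose k) =
     (real ((t + k) choose k) / real ((t + i + k) choose k)) *
      (real (Suc (t + i)) / real (Suc (t + i) + k))" for t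
    by presburger
  moreover have "(\<lambda>t. real (Suc (t + i)) / real (Suc (t + i) + k)) \<longlonglongrightarrow> 1"
    by real_asymp
  ultimately show ?case
    using tendsto_mult[OF Suc.IH, of "\<lambda>t. real (Suc (t + i)) / real (Suc (t + i) + k)" 1] by simp
qed simp

lemma spline_ratio_tendsto: "(\<lambda>j. spline (Suc k) j i / spline (Suc k) j 0) \<longlonglongrightarrow> 1"
proof (rule LIMSEQ_offset[of _ i])
  show "(\<lambda>t. spline (Suc k) (t + i) i / spline (Suc k) (t + i) 0) \<longlonglongrightarrow> 1"
    using binomial_shift_ratio[of k i] by (simp add: spline_def)
qed

lemma spline_le_0: "spline (Suc k) j i \<le> spline (Suc k) j 0"
  by (auto simp: spline_def intro: binomial_right_mono)

text \<open>Both primitives are normalised by the spline value at 0. On the finite support of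
  \<open>q\<close> the spline ratios tend to 1 and recover the mass of \<open>q\<close>; for
  \<open>g\<close> they are at most 1, so the mass of \<open>g\<close> is an upper bound
  throughout.\<close>

lemma mass_ge_1:
  assumes g: "g \<in> k_monotone_subprobs (Suc k)"
    and ge: "\<And>j. iter_prim (Suc k) q j \<le> iter_prim (Suc k) g j"
  shows "1 \<le> suminf g"
proof -
  let ?S = "{i. q i \<noteq> 0}"
  have "(\<lambda>j. \<Sum>i\<in>?S. spline (Suc k) j i / spline (Suc k) j 0 * q i) \<longlonglongrightarrow> (\<Sum>i\<in>?S. 1 * q i)"
    by (intro tendsto_intros spline_ratio_tendsto)
  moreover have "(\<Sum>i\<in>?S. 1 * q i) = 1"
    using sums_unique2[OF sums_finite[OF q_fin, of q] q_sums] by simp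
  moreover have "(\<Sum>i\<in>?S. spline (Suc k) j i / spline (Suc k) j 0 * q i) \<le> suminf g" for j
  proof -
    have pos: "0 < spline (Suc k) j 0" by (simp add: spline_def)
    have "(\<Sum>i\<in>?S. spline (Suc k) j i * q i) = iter_prim (Suc k) q j"
      by (rule sums_unique2[OF sums_finite[OF q_fin] spline_sums]) simp
    also have "\<dots> \<le> iter_prim (Suc k) g j" by (rule ge)
    also have "\<dots> \<le> spline (Suc k) j 0 * suminf g"
    proof (rule sums_le[OF _ spline_sums])
      show "(\<lambda>i. spline (Suc k) j 0 * g i) sums (spline (Suc k) j 0 * suminf g)"
        by (intro sums_mult summable_sums subprobs_summable[OF g])
      show "spline (Suc k) j i * g i \<le> spline (Suc k) j 0 * g i" for i
        using g by (intro mult_right_mono spline_le_0) (auto simp: k_monotone_subprobs_def)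
    qed
    finally show ?thesis
      using pos by (simp add: sum_divide_distrib[symmetric] field_simps)
  qed
  ultimately show ?thesis
    by (metis (no_types, lifting) LIMSEQ_le_const2)
qed

text \<open>A minimiser among subprobabilities of mass below 1 could be moved in the direction of every
  spline, so its iterated primitives would dominate those of \<open>q\<close>, forcing mass at least 1.\<close>
lemma exists_min_probs:
  obtains g where "g \<in> k_monotone_probs (Suc k)"
    and "\<And>f. f \<in> k_monotone_probs (Suc k) \<Longrightarrow>
      l2_norm_sq (\<lambda>i. g i - q i) \<le> l2_norm_sq (\<lambda>i. f i - q i)"
proof -
  obtain g where g: "g \<in> k_monotone_subprobs (Suc k)"
    and min: "\<And>f. f \<in> k_monotone_subprobs (Suc k) \<Longrightarrow>
      l2_norm_sq (\<lambda>i. g i - q i) \<le> l2_norm_sq (\<lambda>i. f i - q i)"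
    using exists_min_subprobs[of "Suc k"] by blast
  have "suminf g = 1"
  proof (rule ccontr)
    assume "suminf g \<noteq> 1"
    with g have lt: "suminf g < 1" by (auto simp: subprobs_iff)
    have "iter_prim (Suc k) q j \<le> iter_prim (Suc k) g j" for j
    proof -
      let ?m = "spline_mass (Suc k) j"
      have "0 \<le> (\<Sum>i. (g i - q i) * spline (Suc k) j i)"
      proof (rule nonneg_of_perturbation[OF subprobs_residual_summable_sq[OF g]])
        \<comment> \<open>Adding \<open>e\<close> times the spline adds mass \<open>e * ?m\<close>,
          so the missing mass \<open>1 - suminf g\<close> caps the step.\<close>
        show "0 < (1 - suminf g) / ?m" using lt spline_mass_pos by simp
        show "summable (\<lambda>i. (spline (Suc k) j i)\<^sup>2)"
          by (intro summable_sq_of_nonneg sums_summable[OF spline_sums_mass] spline_nonneg)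
        fix e assume e: "0 < e" "e \<le> (1 - suminf g) / ?m"
        have "(\<lambda>i. 1 * g i + e * spline (Suc k) j i) sums (1 * suminf g + e * ?m)"
          by (intro sums_add sums_mult spline_sums_mass summable_sums subprobs_summable[OF g])
        moreover have "suminf g + e * ?m \<le> 1"
          using e spline_mass_pos[of k j] by (simp add: field_simps)
        moreover have "k_monotone (Suc k) (\<lambda>i. 1 * g i + e * spline (Suc k) j i)"
          using e g by (intro k_monotone_lin k_monotone_spline) (auto simp: subprobs_iff)
        ultimately have "(\<lambda>i. g i + e * spline (Suc k) j i) \<in> k_monotone_subprobs (Suc k)"
          using e g by (auto simp: subprobs_iff sums_iff spline_nonneg)
        from min[OF this]
        show "l2_norm_sq (\<lambda>i. g i - q i) \<le> l2_norm_sq (\<lambda>i. g i - q i + e * spline (Suc k) j i)"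
          by (simp add: algebra_simps)
      qed
      also have "\<dots> = iter_prim (Suc k) (\<lambda>i. g i - q i) j"
        using spline_sums[of k j "\<lambda>i. g i - q i"]
        by (simp add: sums_iff mult.commute del: iter_prim.simps)
      finally show ?thesis by (simp add: iter_prim_diff del: iter_prim.simps)
    qed
    from mass_ge_1[OF g this] lt show False by simp
  qed
  with g have "g \<in> k_monotone_probs (Suc k)"
    by (auto simp: k_monotone_probs_iff subprobs_iff sums_iff)
  then show ?thesis
    using that min probs_subset_subprobs by blast
qed

lemma lse_characterization:
  "(f \<in> k_monotone_probs (Suc k) \<and>
     (\<forall>l. iter_prim (Suc k) f l - iter_prim (Suc k) q l \<ge> beta q f * spline_mass (Suc k) l) \<and>
     (\<forall>l. k_knot (Suc k) f l \<longrightarrow>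
        iter_prim (Suc k) f l - iter_prim (Suc k) q l = beta q f * spline_mass (Suc k) l))
    \<longleftrightarrow> f = lse (Suc k) q" (is "?cond \<longleftrightarrow> _")
proof -
  let ?D = "\<lambda>f. l2_norm_sq (\<lambda>i. f i - q i)"
  let ?P = "\<lambda>f. f \<in> k_monotone_probs (Suc k)"
  obtain g where "is_arg_min ?D ?P g"
    using exists_min_probs[of k] unfolding is_arg_min_linorder by metis
  \<comment> \<open>\<open>arg_min\<close> is a choice operator; existence guarantees that the
    chosen element is a genuine minimiser.\<close>
  then have lse: "is_arg_min ?D ?P (lse (Suc k) q)"
    unfolding lse_def arg_min_def by (rule someI[of "is_arg_min ?D ?P"])
  show ?thesis
  proof
    assume c: ?cond
    then have "?D f < ?D h" if "?P h" "h \<noteq> f" for h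
      using that by (intro conditions_imp_strict_min) auto
    then show "f = lse (Suc k) q"
      using lse c unfolding is_arg_min_def by metis
  next
    assume "f = lse (Suc k) q"
    with lse have "?P f" "\<And>h. ?P h \<Longrightarrow> ?D f \<le> ?D h"
      unfolding is_arg_min_linorder by auto
    then show ?cond
      using min_imp_conditions by blast
  qed
qed

end

section \<open>The empirical mass function as a finitely supported sequence of total mass 1\<close>

lemma empirical_finite_support: "finite {j. empirical n x j \<noteq> 0}"
proof (rule finite_subset)
  show "{j. empirical n x j \<noteq> 0} \<subseteq> x ` {1..n}"
    by (auto simp: empirical_def elim!: sum.not_neutral_contains_not_neutral split: if_splits)
qed simp

lemma empirical_sums_1:
  assumes "1 \<le> n"
  shows "empirical n x sums 1"
proof -
  have "(\<lambda>j. of_bool (x i = j) :: real) sums 1" for i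
    using sums_finite[of "{x i}" "\<lambda>j. of_bool (x i = j) :: real"] by auto
  then have "(\<lambda>j. \<Sum>i=1..n. of_bool (x i = j) :: real) sums (\<Sum>i=1..n. 1)"
    by (intro sums_sum)
  then have "empirical n x sums (1 / real n * (\<Sum>i=1..n. 1))"
    unfolding empirical_def by (rule sums_mult)
  then show ?thesis using assms by simp
qed

theorem theorem1:
  fixes M :: "'a measure" and X :: "nat \<Rightarrow> 'a \<Rightarrow> nat" and p :: "nat pmf"
    and n k :: nat and \<omega> :: 'a and f :: "nat \<Rightarrow> real"
  assumes "prob_space M"
    and "n \<ge> 1"
    and "prob_space.indep_vars M (\<lambda>_. count_space UNIV) X {1..n}"
    and "\<forall>i\<in>{1..n}. distr M (count_space UNIV) (X i) = measure_pmf p"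
    and "\<omega> \<in> space M"
    and "k \<ge> 2"
  shows "let q = empirical n (\<lambda>i. X i \<omega>) in
    (f \<in> k_monotone_probs k \<and>
     (\<forall>l. iter_prim k f l - iter_prim k q l \<ge> beta q f * spline_mass k l) \<and>
     (\<forall>l. k_knot k f l \<longrightarrow>
        iter_prim k f l - iter_prim k q l = beta q f * spline_mass k l))
    \<longleftrightarrow> f = lse k q"
proof -
  \<comment> \<open>The successor form is the one in which \<open>k - 1\<close> in the splines is an
    exact subtraction.\<close>
  obtain k' where "k = Suc k'" using assms(6) by (cases k) auto
  then show ?thesis
    unfolding Let_def
    using lse_characterization[OF empirical_finite_support empirical_sums_1[OF assms(2)]]
    by (simp only:)
qed

end
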